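(* Let $G=(V,E)$ be a connected undirected graph with positive edge resistances $r\in\mathbb{R}^E$, let $\mathbf{b}\in\mathbb{R}^V$ satisfy $\sum_{i\in V} b(i)=0$, let $\mathbf{L}$ be the Laplacian of $G$ with respect to $r$, and let $\mathbf{p}^*$ satisfy $\mathbf{L}\mathbf{p}^*=\mathbf{b}$. Let $T$ be any spanning tree of $G$ and run Algorithm Dual KOSZ (described in the context) with this tree for $K$ iterations, where $K$ is an integer with $K \ge \tau\ln(1/\epsilon)$ and $\epsilon\in(0,1)$. Then the returned potentials $\mathbf{p}=\mathbf{p}^K$ satisfy $$\mathbb{E}\,\|\mathbf{p}^*-\mathbf{p}\|_{\mathbf{L}}^2 \le \epsilon\,\|\mathbf{p}^*\|_{\mathbf{L}}^2 .$$
   Context: The Laplacian is $\mathbf{L}=\sum_{ij\in E}\frac{1}{r(i,j)}(\mathbf{e}_i-\mathbf{e}_j)(\mathbf{e}_i-\mathbf{e}_j)^\top$, and $\|\mathbf{x}\|_{\mathbf{L}}^2=\mathbf{x}^\top\mathbf{L}\mathbf{x}$. For a tree edge $(i,j)\in T$, let $C(i,j)$ be the vertex set of the component of $T-ij$ containing $i$. For $C\subset V$, let $\delta(C)$ be the set of edges of $G$ with exactly one endpoint in $C$, $S(C)=\sum_{v\in C}b(v)$, $R(C)=\big(\sum_{kl\in\delta(C)}1/r(k,l)\big)^{-1}$, and for potentials $\mathbf{p}\in\mathbb{R}^V$, $f(C)=\sum_{kl\in E,\,k\in C,\,l\notin C}\frac{p(k)-p(l)}{r(k,l)}$. Let $\tau=\sum_{(i,j)\in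 T}\frac{r(i,j)}{R(C(i,j))}$ and $P_{ij}=\frac{1}{\tau}\frac{r(i,j)}{R(C(i,j))}$ for $(i,j)\in T$. Algorithm Dual KOSZ: set $\mathbf{p}^0=\mathbf{0}$; in each iteration $t$, independently sample a tree edge $(i,j)\in T$ with probability $P_{ij}$, let $C=C(i,j)$, compute $\Delta^t=(S(C)-f^t(C))R(C)$ where $f^t(C)$ is $f(C)$ evaluated at $\mathbf{p}^t$, and set $p^{t+1}(v)=p^t(v)+\Delta^t$ for $v\in C$ and $p^{t+1}(v)=p^t(v)$ otherwise. After $K$ iterations return $\mathbf{p}^K$. *)

theory Defs
  imports "HOL-Probability.Probability"
begin

text \<open>
  The vertex set is the universe of a finite type, so that vectors indexed by vertices are
  \<open>real ^ 'n\<close>. An undirected edge is a two-element set of vertices, and resistances are a function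
  on such sets. The notion of tree in \<open>Graph_Theory\<close> is not used: it only excludes directed
  cycles, and a pair of opposite arcs already counts as one.
\<close>

definition simple_edges :: "'n set set \<Rightarrow> bool" where
  "simple_edges E \<longleftrightarrow> (\<forall>e\<in>E. card e = 2)"

definition adj :: "'n set set \<Rightarrow> ('n \<times> 'n) set" where
  "adj F = {(u, v). {u, v} \<in> F}"

definition graph_connected :: "'n set set \<Rightarrow> bool" where
  "graph_connected F \<longleftrightarrow> (\<forall>u v. (u, v) \<in> (adj F)\<^sup>*)"

definition is_cycle :: "'n set set \<Rightarrow> 'n list \<Rightarrow> bool" where
  "is_cycle F vs \<longleftrightarrow> 3 \<le> length vs \<and> distinct vs \<and>
     (\<forall>k<length vs. {vs ! k, vs ! (Suc k mod length vs)} \<in> F)"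

definition spanning_tree :: "'n set set \<Rightarrow> 'n set set \<Rightarrow> bool" where
  "spanning_tree E T \<longleftrightarrow> T \<subseteq> E \<and> graph_connected T \<and> (\<nexists>vs. is_cycle T vs)"

text \<open>
  The cut of a tree edge depends on which endpoint is named first. An orientation \<open>A\<close> of \<open>T\<close>
  fixes one ordered pair for every edge of \<open>T\<close>.
\<close>

definition orientation :: "('n \<times> 'n) set \<Rightarrow> 'n set set \<Rightarrow> bool" where
  "orientation A T \<longleftrightarrow> bij_betw (\<lambda>(i, j). {i, j}) A T"

definition edge_vec :: "'n::finite \<Rightarrow> 'n \<Rightarrow> real ^ 'n" where
  "edge_vec i j = axis i 1 - axis j 1"

definition edge_matrix :: "'n::finite set \<Rightarrow> real ^ 'n ^ 'n" where
  "edge_matrix e = (let (i, j) = (SOME (i, j). e = {i, j})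
     in (columnvector (edge_vec i j) :: real ^ 1 ^ 'n) ** rowvector (edge_vec i j))"

text \<open>The choice of endpoint order in \<^const>\<open>edge_matrix\<close> is immaterial.\<close>

lemma edge_matrix_pair:
  "edge_matrix {i, j} = (columnvector (edge_vec i j) :: real ^ 1 ^ 'n::finite) ** rowvector (edge_vec i j)"
proof -
  define q where "q = (SOME (k, l). {i, j} = {k, l})"
  have "case q of (k, l) \<Rightarrow> {i, j} = {k, l}"
    unfolding q_def by (rule someI[where x = "(i, j)"]) simp
  moreover have "(columnvector (edge_vec j i) :: real ^ 1 ^ 'n) ** rowvector (edge_vec j i)
      = (columnvector (edge_vec i j) :: real ^ 1 ^ 'n) ** rowvector (edge_vec i j)"
    by (simp add: vec_eq_iff matrix_matrix_mult_def columnvector_def rowvector_def edge_vec_def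
        algebra_simps)
  ultimately show ?thesis
    unfolding edge_matrix_def q_def[symmetric] by (auto simp: doubleton_eq_iff)
qed

definition laplacian :: "'n::finite set set \<Rightarrow> ('n set \<Rightarrow> real) \<Rightarrow> real ^ 'n ^ 'n" where
  "laplacian E r = (\<Sum>e\<in>E. (1 / r e) *\<^sub>R edge_matrix e)"

definition sqnorm :: "real ^ 'n ^ 'n \<Rightarrow> real ^ 'n::finite \<Rightarrow> real" where
  "sqnorm L x = x \<bullet> (L *v x)"

definition tree_cut :: "'n set set \<Rightarrow> 'n \<times> 'n \<Rightarrow> 'n set" where
  "tree_cut T = (\<lambda>(i, j). {v. (i, v) \<in> (adj (T - {{i, j}}))\<^sup>*})"

definition boundary :: "'n set set \<Rightarrow> 'n set \<Rightarrow> 'n set set" where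
  "boundary E C = {e \<in> E. card (e \<inter> C) = 1}"

definition cut_supply :: "real ^ 'n \<Rightarrow> 'n::finite set \<Rightarrow> real" where
  "cut_supply b C = (\<Sum>v\<in>C. b $ v)"

definition cut_resistance :: "'n set set \<Rightarrow> ('n set \<Rightarrow> real) \<Rightarrow> 'n set \<Rightarrow> real" where
  "cut_resistance E r C = inverse (\<Sum>e\<in>boundary E C. 1 / r e)"

definition cut_flow ::
  "'n::finite set set \<Rightarrow> ('n set \<Rightarrow> real) \<Rightarrow> real ^ 'n \<Rightarrow> 'n set \<Rightarrow> real" where
  "cut_flow E r p C =
     (\<Sum>(k, l) \<in> {(k, l). {k, l} \<in> E \<and> k \<in> C \<and> l \<notin> C}. (p $ k - p $ l) / r {k, l})"

definition cut_ratio ::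
  "'n set set \<Rightarrow> ('n set \<Rightarrow> real) \<Rightarrow> 'n set set \<Rightarrow> 'n \<times> 'n \<Rightarrow> real" where
  "cut_ratio E r T = (\<lambda>(i, j). r {i, j} / cut_resistance E r (tree_cut T (i, j)))"

definition tau ::
  "'n set set \<Rightarrow> ('n set \<Rightarrow> real) \<Rightarrow> 'n set set \<Rightarrow> ('n \<times> 'n) set \<Rightarrow> real" where
  "tau E r T A = (\<Sum>a\<in>A. cut_ratio E r T a)"

definition edge_prob ::
  "'n set set \<Rightarrow> ('n set \<Rightarrow> real) \<Rightarrow> 'n set set \<Rightarrow> ('n \<times> 'n) set \<Rightarrow> 'n \<times> 'n \<Rightarrow> real" where
  "edge_prob E r T A a = (if a \<in> A then 1 / tau E r T A * cut_ratio E r T a else 0)"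

text \<open>
  If there is only one vertex, \<open>A\<close> is empty, \<^const>\<open>edge_prob\<close> is not a distribution and
  the following is an unspecified one; the Laplacian is then zero. Otherwise see
  \<open>pmf_edge_pmf\<close> below.
\<close>

definition edge_pmf ::
  "'n set set \<Rightarrow> ('n set \<Rightarrow> real) \<Rightarrow> 'n set set \<Rightarrow> ('n \<times> 'n) set \<Rightarrow> ('n \<times> 'n) pmf" where
  "edge_pmf E r T A = embed_pmf (edge_prob E r T A)"

lemma pmf_edge_pmf:
  fixes A :: "('n::finite \<times> 'n) set"
  assumes pos: "\<And>e. e \<in> E \<Longrightarrow> r e > 0"
    and A: "\<And>i j. (i, j) \<in> A \<Longrightarrow> {i, j} \<in> E"
    and nz: "tau E r T A \<noteq> 0"
  shows "pmf (edge_pmf E r T A) a = edge_prob E r T A a"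
proof -
  have "cut_resistance E r C \<ge> 0" for C
    unfolding cut_resistance_def boundary_def using pos
    by (auto intro!: sum_nonneg simp: less_imp_le)
  then have ratio: "cut_ratio E r T a \<ge> 0" if "a \<in> A" for a
    using that pos[OF A] unfolding cut_ratio_def
    by (cases a) (simp add: divide_nonneg_nonneg less_imp_le)
  then have tau: "tau E r T A \<ge> 0"
    unfolding tau_def by (rule sum_nonneg)
  have nonneg: "edge_prob E r T A a \<ge> 0" for a
    using ratio tau by (auto simp: edge_prob_def)
  have "(\<Sum>a\<in>UNIV. edge_prob E r T A a) = (\<Sum>a\<in>A. 1 / tau E r T A * cut_ratio E r T a)"
    unfolding edge_prob_def by (simp add: sum.If_cases)
  also have "\<dots> = 1"
    using nz by (simp flip: sum_distrib_left sum_divide_distrib add: tau_def)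
  finally have "(\<integral>\<^sup>+ a. ennreal (edge_prob E r T A a) \<partial>count_space UNIV) = 1"
    using nonneg by (simp add: nn_integral_count_space_finite)
  then show ?thesis
    unfolding edge_pmf_def using nonneg by (rule pmf_embed_pmf[rotated])
qed

definition kosz_step ::
  "'n::finite set set \<Rightarrow> ('n set \<Rightarrow> real) \<Rightarrow> real ^ 'n \<Rightarrow> 'n set set \<Rightarrow> real ^ 'n \<Rightarrow> 'n \<times> 'n \<Rightarrow> real ^ 'n"
where
  "kosz_step E r b T p a =
     (let C = tree_cut T a;
          \<Delta> = (cut_supply b C - cut_flow E r p C) * cut_resistance E r C
      in \<chi> v. if v \<in> C then p $ v + \<Delta> else p $ v)"

primrec dual_kosz ::
  "'n::finite set set \<Rightarrow> ('n set \<Rightarrow> real) \<Rightarrow> real ^ 'n \<Rightarrow> 'n set set \<Rightarrow> ('n \<times> 'n) set \<Rightarrow> nat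
    \<Rightarrow> (real ^ 'n) pmf"
where
  "dual_kosz E r b T A 0 = return_pmf 0"
| "dual_kosz E r b T A (Suc t) =
     bind_pmf (dual_kosz E r b T A t) (\<lambda>p.
     bind_pmf (edge_pmf E r T A) (\<lambda>a.
     return_pmf (kosz_step E r b T p a)))"

end

theory Submission
  imports Defs
begin

text \<open>
  Write \<open>x = p\<^sup>* - p\<close> for the error and \<open>1\<^sub>C\<close> for the indicator of \<open>C\<close>. A step with cut \<open>C\<close> moves
  \<open>x\<close> along \<open>1\<^sub>C\<close> to the minimiser of the energy on that line, which lowers the energy by
  \<open>R(C) g\<^sub>C\<^sup>2\<close>, where \<open>g\<^sub>C = 1\<^sub>C \<bullet> L x\<close>. With the sampling probabilities \<open>P\<close> the expected decrease is
  \<open>(1/\<tau>) \<Sum> r(a) g\<^sub>a\<^sup>2\<close> over the tree edges \<open>a\<close>, that is \<open>1/\<tau>\<close> times the energy of the flow on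
  the tree with divergence \<open>L x\<close>. By Thomson's principle this is at least \<open>\<parallel>x\<parallel>\<^sub>L\<^sup>2 / \<tau>\<close>, so that
  each iteration contracts the expected energy by \<open>1 - 1/\<tau> \<le> exp (-1/\<tau>)\<close>.
\<close>

definition ind :: "'n::finite set \<Rightarrow> real ^ 'n" where
  "ind C = (\<chi> v. if v \<in> C then 1 else 0)"

lemma ind_nth [simp]: "ind C $ v = (if v \<in> C then 1 else 0)"
  by (simp add: ind_def)

lemma ind_inner: "ind C \<bullet> x = (\<Sum>v\<in>C. x $ v)"
  by (simp add: inner_vec_def if_distrib[of "\<lambda>c. c * _"] sum.If_cases cong: if_cong)

subsection \<open>The Laplacian form\<close>

lemma inner_edge_matrix:
  fixes x y :: "real ^ 'n::finite"
  shows "x \<bullet> (edge_matrix {i, j} *v y) = (x $ i - x $ j) * (y $ i - y $ j)"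
proof -
  have dot: "edge_vec i j \<bullet> z = z $ i - z $ j" for z :: "real ^ 'n"
    by (simp add: edge_vec_def inner_diff_left inner_axis')
  have "edge_matrix {i, j} *v y = (edge_vec i j \<bullet> y) *\<^sub>R edge_vec i j"
    by (simp add: edge_matrix_pair vec_eq_iff matrix_vector_mult_def matrix_matrix_mult_def
        columnvector_def rowvector_def inner_vec_def sum_distrib_left algebra_simps)
  then show ?thesis
    by (simp add: dot inner_commute[of x])
qed

lemma matrix_vector_mult_sum_left:
  fixes M :: "'i \<Rightarrow> real ^ 'n::finite ^ 'm::finite"
  shows "(\<Sum>e\<in>S. M e) *v y = (\<Sum>e\<in>S. M e *v y)"
  by (induction S rule: infinite_finite_induct) (simp_all add: matrix_vector_mult_add_rdistrib)

lemma inner_laplacian: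
  "x \<bullet> (laplacian E r *v y) = (\<Sum>e\<in>E. (x \<bullet> (edge_matrix e *v y)) / r e)"
  by (simp add: laplacian_def matrix_vector_mult_sum_left inner_sum_right
      flip: scaleR_matrix_vector_assoc)

lemma simple_edgesE:
  assumes "simple_edges E" "e \<in> E"
  obtains i j where "e = {i, j}" "i \<noteq> j"
  using assms by (auto simp: simple_edges_def card_2_iff)

lemma inner_edge_matrix_commute:
  assumes "simple_edges E" "e \<in> E"
  shows "x \<bullet> (edge_matrix e *v y) = y \<bullet> (edge_matrix e *v x)"
  using assms by (auto elim!: simple_edgesE simp: inner_edge_matrix)

lemma inner_edge_matrix_nonneg:
  assumes "simple_edges E" "e \<in> E"
  shows "0 \<le> x \<bullet> (edge_matrix e *v x)"
  using assms by (auto elim!: simple_edgesE simp: inner_edge_matrix)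

lemma inner_laplacian_commute:
  assumes "simple_edges E"
  shows "x \<bullet> (laplacian E r *v y) = y \<bullet> (laplacian E r *v x)"
  unfolding inner_laplacian
  by (intro sum.cong refl arg_cong2[where f = "(/)"] inner_edge_matrix_commute[OF assms])

lemma sqnorm_laplacian_nonneg:
  assumes "simple_edges E" "\<And>e. e \<in> E \<Longrightarrow> r e > 0"
  shows "0 \<le> sqnorm (laplacian E r) x"
  unfolding sqnorm_def inner_laplacian
  using assms by (intro sum_nonneg divide_nonneg_nonneg inner_edge_matrix_nonneg less_imp_le)

text \<open>The all-ones vector has no potential difference across any edge. This supplies the
  zero-sum hypothesis of \<open>tree_expansion\<close> for \<open>y = L x\<close>.\<close>

lemma sum_laplacian_mult_vec:
  assumes "simple_edges E"
  shows "(\<Sum>v\<in>UNIV. (laplacian E r *v x) $ v) = 0"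
proof -
  have "(\<Sum>v\<in>UNIV. (laplacian E r *v x) $ v) = ind UNIV \<bullet> (laplacian E r *v x)"
    by (simp add: ind_inner)
  also have "\<dots> = 0"
    unfolding inner_laplacian
    by (rule sum.neutral) (auto elim!: simple_edgesE[OF assms] simp: inner_edge_matrix)
  finally show ?thesis .
qed

subsection \<open>Cuts\<close>

lemma boundary_pair:
  assumes "i \<noteq> j"
  shows "{i, j} \<in> boundary E C \<longleftrightarrow> {i, j} \<in> E \<and> (i \<in> C \<longleftrightarrow> j \<notin> C)"
  using assms by (auto simp: boundary_def Int_insert_left card_insert_if)

text \<open>\<open>cut_flow\<close> sums over pairs directed out of \<open>C\<close>, while
  \<open>cut_resistance\<close> sums over undirected edges; each boundary edge has exactly one
  direction leaving \<open>C\<close>, so either sum can be rewritten as the other kind.\<close>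

lemma bij_betw_boundary:
  assumes "simple_edges E"
  shows "bij_betw (\<lambda>(k, l). {k, l}) {(k, l). {k, l} \<in> E \<and> k \<in> C \<and> l \<notin> C} (boundary E C)"
proof (rule bij_betw_imageI)
  show "inj_on (\<lambda>(k, l). {k, l}) {(k, l). {k, l} \<in> E \<and> k \<in> C \<and> l \<notin> C}"
    by (auto simp: inj_on_def doubleton_eq_iff)
  show "(\<lambda>(k, l). {k, l}) ` {(k, l). {k, l} \<in> E \<and> k \<in> C \<and> l \<notin> C} = boundary E C"
    (is "?f ` ?S = _")
  proof (intro subset_antisym subsetI)
    fix e assume "e \<in> ?f ` ?S"
    then obtain k l where "e = {k, l}" "{k, l} \<in> E" "k \<in> C" "l \<notin> C"
      by auto
    then show "e \<in> boundary E C"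
      by (subst \<open>e = {k, l}\<close>, subst boundary_pair) auto
  next
    fix e assume e: "e \<in> boundary E C"
    then have "e \<in> E" by (simp add: boundary_def)
    then obtain i j where ij: "e = {i, j}" "i \<noteq> j"
      using assms by (blast elim: simple_edgesE)
    with e have "(i, j) \<in> ?S \<or> (j, i) \<in> ?S"
      by (auto simp: boundary_pair insert_commute)
    then show "e \<in> ?f ` ?S"
      using ij by (force simp: insert_commute)
  qed
qed

text \<open>The potential \<open>ind C\<close> drops by 1 along each edge directed out of
  \<open>C\<close> and by 0 along every edge not crossing the cut, so only boundary edges contribute
  to the Laplacian form.\<close>

lemma inner_ind_laplacian:
  assumes "simple_edges E"
  shows "ind C \<bullet> (laplacian E r *v x) = cut_flow E r x C"
proof -
  have "ind C \<bullet> (laplacian E r *v x) =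
      (\<Sum>e\<in>boundary E C. (ind C \<bullet> (edge_matrix e *v x)) / r e)"
    unfolding inner_laplacian
  proof (rule sum.mono_neutral_right)
    show "\<forall>e\<in>E - boundary E C. ind C \<bullet> (edge_matrix e *v x) / r e = 0"
    proof
      fix e assume e: "e \<in> E - boundary E C"
      then obtain i j where "e = {i, j}" "i \<noteq> j"
        using assms by (blast elim: simple_edgesE)
      with e show "ind C \<bullet> (edge_matrix e *v x) / r e = 0"
        by (auto simp: inner_edge_matrix boundary_pair)
    qed
  qed (auto simp: boundary_def)
  also have "\<dots> = cut_flow E r x C"
    unfolding cut_flow_def
    by (subst sum.reindex_bij_betw[OF bij_betw_boundary[OF assms], symmetric])
      (auto intro!: sum.cong simp: inner_edge_matrix)
  finally show ?thesis .
qed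

lemma cut_flow_ind:
  assumes "simple_edges E"
  shows "cut_flow E r (ind C) C = (\<Sum>e\<in>boundary E C. 1 / r e)"
  unfolding cut_flow_def
  by (subst sum.reindex_bij_betw[OF bij_betw_boundary[OF assms], symmetric])
    (auto intro!: sum.cong)

lemma kosz_step_eq:
  "kosz_step E r b T p a = p +
     ((cut_supply b (tree_cut T a) - cut_flow E r p (tree_cut T a))
        * cut_resistance E r (tree_cut T a)) *\<^sub>R ind (tree_cut T a)"
  by (simp add: kosz_step_def Let_def vec_eq_iff)

lemma sqnorm_kosz_step:
  assumes E: "simple_edges E" and b: "laplacian E r *v q = b"
  defines "L \<equiv> laplacian E r"
  shows "sqnorm L (q - kosz_step E r b T p a) =
    sqnorm L (q - p) - cut_resistance E r (tree_cut T a) * (ind (tree_cut T a) \<bullet> (L *v (q - p)))\<^sup>2"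
proof -
  define C where "C = tree_cut T a"
  define R where "R = cut_resistance E r C"
  define x where "x = q - p"
  define g where "g = ind C \<bullet> (L *v x)"
  \<comment> \<open>The residual is computed from \<open>b\<close> and \<open>p\<close> alone; since
    \<open>L q = b\<close>, it is the derivative of the energy along \<open>ind C\<close> at the
    unknown error, up to a factor 2.\<close>
  have g: "cut_supply b C - cut_flow E r p C = g"
    using b inner_ind_laplacian[OF E, of C r p]
    by (simp add: g_def x_def L_def cut_supply_def matrix_vector_mult_diff_distrib
        inner_diff_right flip: ind_inner)
  have x': "q - kosz_step E r b T p a = x - (g * R) *\<^sub>R ind C"
    by (simp add: kosz_step_eq x_def R_def g flip: C_def)
  have sym: "x \<bullet> (L *v ind C) = g"
    unfolding g_def L_def by (rule inner_laplacian_commute[OF E])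
  have CC: "ind C \<bullet> (L *v ind C) = inverse R"
    unfolding L_def inner_ind_laplacian[OF E] cut_flow_ind[OF E] R_def cut_resistance_def by simp
  \<comment> \<open>The case \<open>R = 0\<close>, which arises for instance from an empty boundary,
    is covered by \<open>inverse 0 = 0\<close>: the step then has length 0 and no energy is
    lost.\<close>
  have RR: "R * R * inverse R = R" by (cases "R = 0") auto
  have "sqnorm L (x - (g * R) *\<^sub>R ind C) = sqnorm L x - 2 * (g * R) * g + g\<^sup>2 * (R * R * inverse R)"
    by (simp add: sqnorm_def matrix_vector_mult_diff_distrib matrix_vector_mult_scaleR
        inner_diff_left inner_diff_right sym CC g_def[symmetric] power2_eq_square algebra_simps)
  also have "\<dots> = sqnorm L x - R * g\<^sup>2"
    unfolding RR by (simp add: power2_eq_square)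
  finally show ?thesis
    by (simp add: x' g_def x_def R_def C_def)
qed

subsection \<open>Fundamental cuts of the tree\<close>

lemma rtrancl_simple_path:
  assumes "(u, v) \<in> R\<^sup>*"
  obtains vs where "vs \<noteq> []" "hd vs = u" "last vs = v" "distinct vs"
    "\<And>k. Suc k < length vs \<Longrightarrow> (vs ! k, vs ! Suc k) \<in> R"
  using assms
proof (induction arbitrary: thesis rule: rtrancl_induct)
  case base
  show ?case by (rule base[of "[u]"]) auto
next
  case (step v w)
  obtain vs where vs: "vs \<noteq> []" "hd vs = u" "last vs = v" "distinct vs"
    "\<And>k. Suc k < length vs \<Longrightarrow> (vs ! k, vs ! Suc k) \<in> R"
    using step.IH by blast
  show ?case
  proof (cases "w \<in> set vs")
    case True
    \<comment> \<open>The walk returns to a vertex it has already visited, so the path is cut back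
      to that vertex.\<close>
    then obtain m where m: "m < length vs" "vs ! m = w"
      by (auto simp: in_set_conv_nth)
    show ?thesis
    proof (rule step.prems[of "take (Suc m) vs"])
      show "last (take (Suc m) vs) = w"
        using m by (simp add: take_Suc_conv_app_nth)
    qed (use vs m in \<open>auto simp: hd_take\<close>)
  next
    case False
    show ?thesis
    proof (rule step.prems[of "vs @ [w]"])
      fix k assume k: "Suc k < length (vs @ [w])"
      show "((vs @ [w]) ! k, (vs @ [w]) ! Suc k) \<in> R"
      proof (cases "Suc k < length vs")
        case True
        then show ?thesis using vs(5) by (simp add: nth_append)
      next
        case False
        with k have "k = length vs - 1" "Suc k = length vs" by auto
        with vs step.hyps(2) show ?thesis
          by (simp add: nth_append last_conv_nth)
      qed
    qed (use vs False in auto)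
  qed
qed

text \<open>A simple path from \<open>i\<close> to \<open>j\<close> that avoids the edge
  \<open>{i, j}\<close> would be closed up by this edge to a cycle of \<open>T\<close>.\<close>

lemma acyclic_edge_separates:
  assumes "\<nexists>vs. is_cycle T vs" and "{i, j} \<in> T" "i \<noteq> j"
  shows "(i, j) \<notin> (adj (T - {{i, j}}))\<^sup>*"
proof
  assume "(i, j) \<in> (adj (T - {{i, j}}))\<^sup>*"
  then obtain vs where vs: "vs \<noteq> []" "hd vs = i" "last vs = j" "distinct vs"
    "\<And>k. Suc k < length vs \<Longrightarrow> (vs ! k, vs ! Suc k) \<in> adj (T - {{i, j}})"
    by (rule rtrancl_simple_path) blast
  have ends: "vs ! 0 = i" "vs ! (length vs - 1) = j"
    using vs by (simp_all add: hd_conv_nth last_conv_nth)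
  have "length vs \<noteq> 1" using ends \<open>i \<noteq> j\<close> by auto
  \<comment> \<open>A path with two vertices would use the deleted edge itself.\<close>
  moreover have "length vs \<noteq> 2" using ends vs(5)[of 0] by (auto simp: adj_def)
  moreover have "length vs \<noteq> 0" using vs(1) by simp
  ultimately have len: "3 \<le> length vs" by linarith
  have "is_cycle T vs"
    unfolding is_cycle_def
  proof (intro conjI allI impI)
    fix k assume k: "k < length vs"
    show "{vs ! k, vs ! (Suc k mod length vs)} \<in> T"
    proof (cases "Suc k = length vs")
      case True
      \<comment> \<open>The index wraps around here: this is the closing edge from \<open>j\<close>
        back to \<open>i\<close>.\<close>
      then have "k = length vs - 1" by simp
      with True show ?thesis
        using assms(2) ends by (simp add: insert_commute)
    next
      case False
      with k vs(5)[of k] show ?thesis by (auto simp: adj_def)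
    qed
  qed (use len vs in auto)
  with assms(1) show False by blast
qed

lemma tree_cut_edge:
  assumes "\<nexists>vs. is_cycle T vs" and "{i, j} \<in> T" "i \<noteq> j"
  shows "i \<in> tree_cut T (i, j)" "j \<notin> tree_cut T (i, j)"
  using acyclic_edge_separates[OF assms] by (auto simp: tree_cut_def)

text \<open>An edge that survives the deletion has both endpoints in the same component.\<close>

lemma tree_cut_other_edge:
  assumes "{k, l} \<in> T" "{k, l} \<noteq> {i, j}"
  shows "k \<in> tree_cut T (i, j) \<longleftrightarrow> l \<in> tree_cut T (i, j)"
proof -
  have "(k, l) \<in> adj (T - {{i, j}})" "(l, k) \<in> adj (T - {{i, j}})"
    using assms by (auto simp: adj_def insert_commute)
  then show ?thesis
    unfolding tree_cut_def by (auto intro: rtrancl.rtrancl_into_rtrancl)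
qed

lemma connected_constant:
  assumes "graph_connected F" and "\<And>k l. {k, l} \<in> F \<Longrightarrow> f k = f l"
  shows "f u = f v"
proof -
  have "(u, v) \<in> (adj F)\<^sup>*" using assms(1) by (simp add: graph_connected_def)
  then show ?thesis
    by (induction rule: rtrancl_induct) (auto simp: adj_def assms(2))
qed

text \<open>
  The indicators of the fundamental cuts are, up to constants, the basis dual to the potential
  differences along tree edges.
\<close>

lemma tree_expansion:
  fixes x y :: "real ^ 'n::finite"
  assumes E: "simple_edges E" and T: "spanning_tree E T" and A: "orientation A T"
    and y: "(\<Sum>v\<in>UNIV. y $ v) = 0"
  shows "x \<bullet> y = (\<Sum>(i, j)\<in>A. (x $ i - x $ j) * (ind (tree_cut T (i, j)) \<bullet> y))"
proof -
  have acyc: "\<nexists>vs. is_cycle T vs" and TE: "T \<subseteq> E" and conn: "graph_connected T"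
    using T by (auto simp: spanning_tree_def)
  have inj: "inj_on (\<lambda>(i, j). {i, j}) A" and img: "(\<lambda>(i, j). {i, j}) ` A = T"
    using A by (auto simp: orientation_def bij_betw_def)
  \<comment> \<open>The remainder of \<open>x\<close> after its expansion in cut indicators. It has
    no difference across any tree edge, hence is constant by connectedness, hence orthogonal to the
    zero-sum vector \<open>y\<close>.\<close>
  define z where "z = x - (\<Sum>(i, j)\<in>A. (x $ i - x $ j) *\<^sub>R ind (tree_cut T (i, j)))"
  have edge: "z $ k = z $ l" if kl: "(k, l) \<in> A" for k l
  proof -
    have klT: "{k, l} \<in> T" using kl img by force
    then have ne: "k \<noteq> l" using E TE by (fastforce simp: simple_edges_def)
    have diff: "ind (tree_cut T (i, j)) $ k - ind (tree_cut T (i, j)) $ l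
        = (if (i, j) = (k, l) then 1 else 0)" if ij: "(i, j) \<in> A" for i j
    proof (cases "(i, j) = (k, l)")
      case True
      then show ?thesis using tree_cut_edge[OF acyc klT ne] by simp
    next
      case False
      \<comment> \<open>An orientation lists each tree edge in only one direction, so
        \<open>(i, j)\<close> cannot be \<open>(l, k)\<close>.\<close>
      then have "{k, l} \<noteq> {i, j}" using inj_onD[OF inj _ kl ij] by auto
      with False tree_cut_other_edge[OF klT this] show ?thesis by simp
    qed
    have "z $ k - z $ l = x $ k - x $ l -
        (\<Sum>(i, j)\<in>A. (x $ i - x $ j) *
          (ind (tree_cut T (i, j)) $ k - ind (tree_cut T (i, j)) $ l))"
      unfolding z_def by (simp add: case_prod_beta sum_subtractf right_diff_distrib
          del: ind_nth)
    also have "(\<Sum>(i, j)\<in>A. (x $ i - x $ j) *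
          (ind (tree_cut T (i, j)) $ k - ind (tree_cut T (i, j)) $ l))
        = (\<Sum>a\<in>A. if a = (k, l) then x $ k - x $ l else 0)"
      by (rule sum.cong) (auto simp: diff simp del: ind_nth split: if_splits)
    also have "\<dots> = x $ k - x $ l"
      using kl by simp
    finally show ?thesis by simp
  qed
  have "z $ k = z $ l" if "{k, l} \<in> T" for k l
  proof -
    have "{k, l} \<in> (\<lambda>(i, j). {i, j}) ` A"
      using that img by simp
    then obtain i j where "(i, j) \<in> A" "{k, l} = {i, j}"
      by auto
    then show ?thesis
      using edge[of i j] by (auto simp: doubleton_eq_iff)
  qed
  then have const: "z $ u = z $ v" for u v
    using connected_constant[OF conn] by blast
  \<comment> \<open>\<open>undefined\<close> merely names some vertex; \<open>z\<close> takes the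
    same value at all of them.\<close>
  define c where "c = z $ undefined"
  have "z \<bullet> y = (\<Sum>v\<in>UNIV. c * y $ v)"
    unfolding inner_vec_def c_def inner_real_def using const by (intro sum.cong) auto
  also have "\<dots> = 0" using y by (simp flip: sum_distrib_left)
  finally show ?thesis
    by (simp add: z_def inner_diff_left inner_sum_left case_prod_beta)
qed

lemma oriented_sum:
  assumes "orientation A T"
  shows "(\<Sum>(i, j)\<in>A. f {i, j}) = (\<Sum>e\<in>T. f e)"
  using sum.reindex_bij_betw[of "\<lambda>(i, j). {i, j}" A T f] assms
  by (simp add: orientation_def case_prod_beta)

text \<open>By \<open>tree_expansion\<close>, the energy of \<open>x\<close> is the sum of
  \<open>d * g\<close> over tree edges, where \<open>d\<close> is the potential difference and
  \<open>g\<close> the tree flow. Since \<open>2 * d * g \<le> d^2 / r + r * g^2\<close>, twice the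
  energy is at most the energy of \<open>x\<close> on \<open>T\<close> plus that of the flow; the
  former is at most the energy of \<open>x\<close> on all of \<open>E\<close> and cancels one
  copy.\<close>

lemma thomson:
  fixes x :: "real ^ 'n::finite"
  assumes E: "simple_edges E" and pos: "\<And>e. e \<in> E \<Longrightarrow> r e > 0"
    and T: "spanning_tree E T" and A: "orientation A T"
  defines "L \<equiv> laplacian E r"
  shows "sqnorm L x \<le> (\<Sum>(i, j)\<in>A. r {i, j} * (ind (tree_cut T (i, j)) \<bullet> (L *v x))\<^sup>2)"
proof -
  define g where "g a = ind (tree_cut T a) \<bullet> (L *v x)" for a
  have TE: "T \<subseteq> E" using T by (simp add: spanning_tree_def)
  have pos': "r {i, j} > 0" if "(i, j) \<in> A" for i j
    using that A TE by (intro pos) (auto simp: orientation_def bij_betw_def)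
  have "2 * sqnorm L x = (\<Sum>(i, j)\<in>A. 2 * ((x $ i - x $ j) * g (i, j)))"
    unfolding sqnorm_def g_def
    by (subst tree_expansion[OF E T A])
      (auto simp: L_def sum_laplacian_mult_vec[OF E] sum_distrib_left case_prod_beta)
  also have "\<dots> \<le> (\<Sum>(i, j)\<in>A. (x $ i - x $ j)\<^sup>2 / r {i, j} + r {i, j} * (g (i, j))\<^sup>2)"
  proof (rule sum_mono, clarify)
    fix i j assume "(i, j) \<in> A"
    then have r: "r {i, j} > 0" by (rule pos')
    have "0 \<le> ((x $ i - x $ j) - r {i, j} * g (i, j))\<^sup>2 / r {i, j}"
      using r by simp
    also have "\<dots> = (x $ i - x $ j)\<^sup>2 / r {i, j} + r {i, j} * (g (i, j))\<^sup>2
        - 2 * ((x $ i - x $ j) * g (i, j))"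
      using r by (simp add: field_simps power2_eq_square)
    finally show "2 * ((x $ i - x $ j) * g (i, j))
        \<le> (x $ i - x $ j)\<^sup>2 / r {i, j} + r {i, j} * (g (i, j))\<^sup>2" by simp
  qed
  also have "\<dots> = (\<Sum>e\<in>T. (x \<bullet> (edge_matrix e *v x)) / r e) + (\<Sum>(i, j)\<in>A. r {i, j} * (g (i, j))\<^sup>2)"
    by (simp add: oriented_sum[OF A, symmetric] case_prod_beta sum.distrib inner_edge_matrix
        power2_eq_square)
  also have "(\<Sum>e\<in>T. (x \<bullet> (edge_matrix e *v x)) / r e) \<le> sqnorm L x"
    unfolding sqnorm_def L_def inner_laplacian
    by (intro sum_mono2 TE divide_nonneg_nonneg inner_edge_matrix_nonneg[OF E] less_imp_le[OF pos])
      auto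
  finally show ?thesis by (simp add: g_def)
qed

subsection \<open>Expected decrease\<close>

text \<open>A tree edge crosses its own fundamental cut, so the total conductance of the boundary is
  positive.\<close>

lemma cut_resistance_tree_cut_pos:
  fixes T :: "'n::finite set set"
  assumes E: "simple_edges E" and pos: "\<And>e. e \<in> E \<Longrightarrow> r e > 0"
    and T: "spanning_tree E T" and ij: "{i, j} \<in> T"
  shows "0 < cut_resistance E r (tree_cut T (i, j))"
proof -
  have acyc: "\<nexists>vs. is_cycle T vs" and ijE: "{i, j} \<in> E"
    using T ij by (auto simp: spanning_tree_def)
  then have ne: "i \<noteq> j" using E by (fastforce simp: simple_edges_def)
  have "{i, j} \<in> boundary E (tree_cut T (i, j))"
    using tree_cut_edge[OF acyc ij ne] ijE ne by (simp add: boundary_pair)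
  then have "0 < (\<Sum>e\<in>boundary E (tree_cut T (i, j)). 1 / r e)"
    using pos by (intro sum_pos) (auto simp: boundary_def)
  then show ?thesis by (simp add: cut_resistance_def)
qed

lemma tau_pos:
  fixes T :: "'n::finite set set"
  assumes E: "simple_edges E" and pos: "\<And>e. e \<in> E \<Longrightarrow> r e > 0"
    and T: "spanning_tree E T" and A: "orientation A T" and ne: "A \<noteq> {}"
  shows "0 < tau E r T A"
  unfolding tau_def
proof (rule sum_pos)
  fix a assume "a \<in> A"
  moreover obtain i j where "a = (i, j)" by fastforce
  ultimately have "{i, j} \<in> T" "{i, j} \<in> E" "a = (i, j)"
    using A T by (auto simp: orientation_def bij_betw_def spanning_tree_def)
  then show "0 < cut_ratio E r T a"
    using cut_resistance_tree_cut_pos[OF E pos T] pos by (simp add: cut_ratio_def)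
qed (use ne in auto)

lemma expected_step:
  fixes T :: "'n::finite set set"
  assumes E: "simple_edges E" and pos: "\<And>e. e \<in> E \<Longrightarrow> r e > 0"
    and T: "spanning_tree E T" and A: "orientation A T" and ne: "A \<noteq> {}"
    and b: "laplacian E r *v q = b"
  defines "L \<equiv> laplacian E r" and "\<tau> \<equiv> tau E r T A"
  shows "measure_pmf.expectation (edge_pmf E r T A) (\<lambda>a. sqnorm L (q - kosz_step E r b T p a))
    \<le> (1 - 1 / \<tau>) * sqnorm L (q - p)"
proof -
  define P where "P = edge_pmf E r T A"
  define g where "g a = ind (tree_cut T a) \<bullet> (L *v (q - p))" for a
  have \<tau>: "\<tau> > 0" unfolding \<tau>_def by (rule tau_pos[OF E pos T A ne])
  have AT: "{i, j} \<in> T" "{i, j} \<in> E" if "(i, j) \<in> A" for i j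
    using that A T by (auto simp: orientation_def bij_betw_def spanning_tree_def)
  have P: "pmf P a = edge_prob E r T A a" for a
    unfolding P_def using \<tau> AT(2) by (intro pmf_edge_pmf pos) (auto simp: \<tau>_def)
  have "measure_pmf.expectation P (\<lambda>a. cut_resistance E r (tree_cut T a) * (g a)\<^sup>2)
      = (\<Sum>a\<in>A. pmf P a * (cut_resistance E r (tree_cut T a) * (g a)\<^sup>2))"
    by (subst integral_measure_pmf_real[where A = A])
      (auto simp: set_pmf_iff P edge_prob_def mult.commute split: if_splits)
  also have "\<dots> = (\<Sum>(i, j)\<in>A. (1 / \<tau>) * (r {i, j} * (g (i, j))\<^sup>2))"
  proof (rule sum.cong, rule refl, clarify)
    fix i j assume ij: "(i, j) \<in> A"
    \<comment> \<open>Positivity lets the cut resistance in the decrease cancel the one in the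
      denominator of the sampling probability, leaving \<open>r {i, j} / \<tau>\<close>.\<close>
    have "0 < cut_resistance E r (tree_cut T (i, j))"
      by (rule cut_resistance_tree_cut_pos[OF E pos T AT(1)[OF ij]])
    then show "pmf P (i, j) * (cut_resistance E r (tree_cut T (i, j)) * (g (i, j))\<^sup>2)
        = (1 / \<tau>) * (r {i, j} * (g (i, j))\<^sup>2)"
      using ij by (simp add: P edge_prob_def cut_ratio_def \<tau>_def)
  qed
  also have "\<dots> = (1 / \<tau>) * (\<Sum>(i, j)\<in>A. r {i, j} * (g (i, j))\<^sup>2)"
    by (simp add: sum_distrib_left case_prod_beta)
  also have "\<dots> \<ge> (1 / \<tau>) * sqnorm L (q - p)"
    unfolding g_def L_def using \<tau> by (intro mult_left_mono thomson[OF E pos T A]) auto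
  finally have decrease: "(1 / \<tau>) * sqnorm L (q - p)
      \<le> measure_pmf.expectation P (\<lambda>a. cut_resistance E r (tree_cut T a) * (g a)\<^sup>2)" .
  have "measure_pmf.expectation P (\<lambda>a. sqnorm L (q - kosz_step E r b T p a))
      = sqnorm L (q - p)
        - measure_pmf.expectation P (\<lambda>a. cut_resistance E r (tree_cut T a) * (g a)\<^sup>2)"
    unfolding L_def g_def sqnorm_kosz_step[OF E b]
    by (subst Bochner_Integration.integral_diff) (auto intro: integrable_measure_pmf_finite)
  with decrease show ?thesis
    by (simp add: P_def algebra_simps)
qed

section \<open>Iterating the contraction\<close>

lemma finite_set_dual_kosz: "finite (set_pmf (dual_kosz E r b T A t))"
  by (induction t) auto

text \<open>Induction with the exponential factor instead of powers of \<open>1 - 1 / \<tau>\<close>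
  requires no information on the sign of \<open>1 - 1 / \<tau>\<close>.\<close>

lemma expected_dual_kosz:
  fixes T :: "'n::finite set set"
  assumes E: "simple_edges E" and pos: "\<And>e. e \<in> E \<Longrightarrow> r e > 0"
    and T: "spanning_tree E T" and A: "orientation A T" and ne: "A \<noteq> {}"
    and b: "laplacian E r *v q = b"
  defines "L \<equiv> laplacian E r" and "\<tau> \<equiv> tau E r T A"
  shows "measure_pmf.expectation (dual_kosz E r b T A t) (\<lambda>p. sqnorm L (q - p))
    \<le> exp (- real t / \<tau>) * sqnorm L q"
proof (induction t)
  case 0
  show ?case by simp
next
  case (Suc t)
  define D where "D = dual_kosz E r b T A t"
  define F where "F p = measure_pmf.expectation (edge_pmf E r T A)
    (\<lambda>a. sqnorm L (q - kosz_step E r b T p a))" for p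
  have fin: "finite (set_pmf D)" unfolding D_def by (rule finite_set_dual_kosz)
  have step: "F p \<le> exp (- 1 / \<tau>) * sqnorm L (q - p)" for p
  proof -
    have "F p \<le> (1 - 1 / \<tau>) * sqnorm L (q - p)"
      unfolding F_def L_def \<tau>_def by (rule expected_step[OF E pos T A ne b])
    also have "\<dots> \<le> exp (- 1 / \<tau>) * sqnorm L (q - p)"
      using exp_ge_add_one_self[of "- 1 / \<tau>"]
      by (intro mult_right_mono) (auto simp: L_def intro: sqnorm_laplacian_nonneg[OF E pos])
    finally show ?thesis .
  qed
  \<comment> \<open>Conditioning on the potentials after \<open>t\<close> rounds; the support is
    finite, so the expectations are finite sums.\<close>
  have "measure_pmf.expectation (dual_kosz E r b T A (Suc t)) (\<lambda>p. sqnorm L (q - p))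
      = measure_pmf.expectation D F"
    using fin unfolding F_def
    by (simp add: D_def[symmetric] pmf_expectation_bind[where A = "set_pmf D"]
        integral_measure_pmf[where A = "set_pmf D"] flip: map_pmf_def)
  also have "\<dots> \<le> measure_pmf.expectation D (\<lambda>p. exp (- 1 / \<tau>) * sqnorm L (q - p))"
    using fin step by (intro integral_mono integrable_measure_pmf_finite)
  also have "\<dots> \<le> exp (- 1 / \<tau>) * (exp (- real t / \<tau>) * sqnorm L q)"
    using Suc.IH by (simp add: D_def)
  also have "\<dots> = exp (- real (Suc t) / \<tau>) * sqnorm L q"
    by (simp add: mult.assoc[symmetric] exp_add[symmetric] add_divide_distrib diff_divide_distrib)
  finally show ?case .
qed

text \<open>Without tree edges, connectedness leaves a single vertex and hence no edge at all. The
  sampling distribution is unspecified in this case, so the final bound is obtained from the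
  vanishing energy instead.\<close>

lemma laplacian_trivial_tree:
  fixes E :: "'n::finite set set"
  assumes E: "simple_edges E" and T: "spanning_tree E T" and A: "orientation A T" and "A = {}"
  shows "laplacian E r = 0"
proof -
  have "T = {}"
    using A \<open>A = {}\<close> by (simp add: orientation_def bij_betw_def)
  then have "graph_connected ({} :: 'n set set)"
    using T by (simp add: spanning_tree_def)
  then have eq: "u = v" for u v :: 'n by (simp add: graph_connected_def adj_def)
  have "E = {}"
  proof (rule ccontr)
    assume "E \<noteq> {}"
    then obtain e where "e \<in> E" by blast
    then obtain i j :: 'n where "i \<noteq> j" by (rule simple_edgesE[OF E])
    with eq show False by blast
  qed
  then show ?thesis by (simp add: laplacian_def)
qed

theorem theorem1:
  fixes E T :: "'n::finite set set"
    and A :: "('n \<times> 'n) set"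
    and r :: "'n set \<Rightarrow> real"
    and b pstar :: "real ^ 'n"
    and K :: nat
    and \<epsilon> :: real
  assumes "simple_edges E"
    and "graph_connected E"
    and "\<And>e. e \<in> E \<Longrightarrow> r e > 0"
    and "(\<Sum>i\<in>UNIV. b $ i) = 0"
    and "laplacian E r *v pstar = b"
    and "spanning_tree E T"
    and "orientation A T"
    and "0 < \<epsilon>" and "\<epsilon> < 1"
    and "real K \<ge> tau E r T A * ln (1 / \<epsilon>)"
  shows "measure_pmf.expectation (dual_kosz E r b T A K)
           (\<lambda>p. sqnorm (laplacian E r) (pstar - p))
         \<le> \<epsilon> * sqnorm (laplacian E r) pstar"
proof (cases "A = {}")
  case True
  then show ?thesis
    using laplacian_trivial_tree[OF assms(1,6,7)] by (simp add: sqnorm_def)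
next
  case False
  define \<tau> where "\<tau> = tau E r T A"
  have \<tau>: "\<tau> > 0" unfolding \<tau>_def by (rule tau_pos[OF assms(1,3,6,7) False])
  have "ln (1 / \<epsilon>) \<le> real K / \<tau>"
    using assms(10) \<tau> by (simp add: \<tau>_def[symmetric] field_simps)
  then have "- real K / \<tau> \<le> ln \<epsilon>"
    using assms(8) by (simp add: ln_div)
  then have "exp (- real K / \<tau>) \<le> \<epsilon>"
    using assms(8) by (metis exp_le_cancel_iff exp_ln)
  then have "exp (- real K / \<tau>) * sqnorm (laplacian E r) pstar \<le> \<epsilon> * sqnorm (laplacian E r) pstar"
    by (rule mult_right_mono) (rule sqnorm_laplacian_nonneg[OF assms(1,3)])
  with expected_dual_kosz[OF assms(1,3,6,7) False assms(5), of K] show ?thesis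
    unfolding \<tau>_def by linarith
qed

end
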